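(* Let $G$ be a finite undirected connected multigraph (possibly with loops) and let $e$ be an edge of $G$ between two distinct vertices $v_1$ and $v_2$ that is not a bridge. For any $(i,j)\in\mathbb{Z}^2$, if $\beta_{i,j}(G/e)=\beta_{i-1,j-1}(G/e)=\beta_{i-1,j}(G/e)=\beta_{i-2,j-1}(G/e)=0$, then $\beta_{i,j}(G)=\beta_{i,j}(G\setminus e)$.
   Context: $G/e$ is obtained from $G$ by merging $v_1$ and $v_2$ into one vertex $v_{1,2}$; the other edges between $v_1$ and $v_2$ (if $e$ has multiplicity $m_e$, there are $m_e-1$ of them) become loops at $v_{1,2}$, and loops of $G$ are kept. $G\setminus e$ is obtained by deleting only the edge $e$. Let $H$ be a connected multigraph with $n$ vertices, $\ell$ loops and $m$ non-loop edges. A connected $r$-partition of $H$ is a partition $\Pi=\{V_1,\dots,V_r\}$ of the vertex set into $r$ nonempty parts such that each part induces a connected subgraph. Its connected partition graph is the loopless multigraph with vertex set $\Pi$ and with $\sum_{u\in V_a,w\in V_b}a_{u,w}$ edges between $V_a$ and $V_b$ ($a\neq b$), where $a_{u,w}$ is the number of edges of $H$ between $u$ and $w$. The number $\beta_{i,j+\ell}(H)$ is the total number of acyclic orientations on connected partition graphs of $H$ with $n-i$ vertices and $m-j$ edges having a unique sink at the part containing a fixed vertex of $H$ (the number does not depend on the fixed vertex; parallel edges are directed the same way in an acyclic orientation). In particular $\beta_{i,j}(H)=0$ for $i<0$ or $i\ge n$. *)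

theory Defs
  imports Main "HOL-Library.FuncSet" "HOL-Library.Disjoint_Sets"
begin

text \<open>Undirected multigraphs with labelled edges: parallel edges are different labels with the
  same set of ends, and a loop at \<open>v\<close> has the set of ends \<open>{v}\<close>.\<close>

record ('v, 'e) mgraph =
  verts :: "'v set"
  edges :: "'e set"
  ends :: "'e \<Rightarrow> 'v set"

definition multigraph :: "('v, 'e) mgraph \<Rightarrow> bool" where
  "multigraph H \<longleftrightarrow> finite (verts H) \<and> finite (edges H) \<and>
     (\<forall>e\<in>edges H. ends H e \<subseteq> verts H \<and> (card (ends H e) = 1 \<or> card (ends H e) = 2))"

definition loops :: "('v, 'e) mgraph \<Rightarrow> 'e set" where
  "loops H = {e \<in> edges H. card (ends H e) = 1}"

definition nonloops :: "('v, 'e) mgraph \<Rightarrow> 'e set" where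
  "nonloops H = {e \<in> edges H. card (ends H e) = 2}"

definition multiplicity :: "('v, 'e) mgraph \<Rightarrow> 'v \<Rightarrow> 'v \<Rightarrow> nat" where
  "multiplicity H u w = card {e \<in> edges H. ends H e = {u, w}}"

definition adjacency :: "('v, 'e) mgraph \<Rightarrow> ('v \<times> 'v) set" where
  "adjacency H = {(u, w). \<exists>e\<in>edges H. ends H e = {u, w}}"

definition connected_graph :: "('v, 'e) mgraph \<Rightarrow> bool" where
  "connected_graph H \<longleftrightarrow>
     verts H \<noteq> {} \<and> (\<forall>u\<in>verts H. \<forall>w\<in>verts H. (u, w) \<in> (adjacency H)\<^sup>*)"

definition induced_subgraph :: "('v, 'e) mgraph \<Rightarrow> 'v set \<Rightarrow> ('v, 'e) mgraph" where
  "induced_subgraph H S =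
     \<lparr>verts = S, edges = {e \<in> edges H. ends H e \<subseteq> S}, ends = ends H\<rparr>"

definition delete_edge :: "('v, 'e) mgraph \<Rightarrow> 'e \<Rightarrow> ('v, 'e) mgraph" where
  "delete_edge H e = \<lparr>verts = verts H, edges = edges H - {e}, ends = ends H\<rparr>"

definition bridge :: "('v, 'e) mgraph \<Rightarrow> 'e \<Rightarrow> bool" where
  "bridge H e \<longleftrightarrow> e \<in> edges H \<and>
     (\<exists>u\<in>verts H. \<exists>w\<in>verts H.
        (u, w) \<in> (adjacency H)\<^sup>* \<and> (u, w) \<notin> (adjacency (delete_edge H e))\<^sup>*)"

text \<open>Contraction of an edge \<open>e\<close> with ends \<open>v1 \<noteq> v2\<close>. The merged vertex is called \<open>v1\<close>.\<close>

definition merge :: "'v \<Rightarrow> 'v \<Rightarrow> 'v \<Rightarrow> 'v" where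
  "merge v1 v2 u = (if u = v2 then v1 else u)"

definition contract_edge :: "('v, 'e) mgraph \<Rightarrow> 'e \<Rightarrow> 'v \<Rightarrow> 'v \<Rightarrow> ('v, 'e) mgraph" where
  "contract_edge H e v1 v2 =
     \<lparr>verts = merge v1 v2 ` verts H, edges = edges H - {e},
      ends = (\<lambda>x. merge v1 v2 ` ends H x)\<rparr>"

definition connected_partition :: "('v, 'e) mgraph \<Rightarrow> 'v set set \<Rightarrow> bool" where
  "connected_partition H P \<longleftrightarrow>
     partition_on (verts H) P \<and> (\<forall>S\<in>P. connected_graph (induced_subgraph H S))"

text \<open>The partition graph keeps as labels the edges of \<open>H\<close> that run between different parts; an
  edge joins the two parts that it meets. The lemma \<open>multiplicity_partition_graph\<close> below gives
  the resulting numbers of parallel edges.\<close>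

definition partition_graph :: "('v, 'e) mgraph \<Rightarrow> 'v set set \<Rightarrow> ('v set, 'e) mgraph" where
  "partition_graph H P =
     \<lparr>verts = P, edges = {e \<in> edges H. \<not> (\<exists>S\<in>P. ends H e \<subseteq> S)},
      ends = (\<lambda>e. {S \<in> P. S \<inter> ends H e \<noteq> {}})\<rparr>"

text \<open>An orientation chooses a head among the ends of every edge. Each edge is oriented
  separately, but in an acyclic orientation parallel edges necessarily have the same head, and
  no acyclic orientation exists if there is a loop.\<close>

definition orientations :: "('v, 'e) mgraph \<Rightarrow> ('e \<Rightarrow> 'v) set" where
  "orientations H = (\<Pi>\<^sub>E e\<in>edges H. ends H e)"

definition oriented_arcs :: "('v, 'e) mgraph \<Rightarrow> ('e \<Rightarrow> 'v) \<Rightarrow> ('v \<times> 'v) set" where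
  "oriented_arcs H h = {(u, w). \<exists>e\<in>edges H. ends H e = {u, w} \<and> h e = w}"

definition acyclic_orientations :: "('v, 'e) mgraph \<Rightarrow> ('e \<Rightarrow> 'v) set" where
  "acyclic_orientations H = {h \<in> orientations H. acyclic (oriented_arcs H h)}"

definition sinks :: "('v, 'e) mgraph \<Rightarrow> ('e \<Rightarrow> 'v) \<Rightarrow> 'v set" where
  "sinks H h = {v \<in> verts H. \<forall>w. (v, w) \<notin> oriented_arcs H h}"

text \<open>\<open>beta H q i j\<close> is \<open>\<beta>\<^sub>i\<^sub>,\<^sub>j(H)\<close> computed with the fixed vertex \<open>q\<close>. The number that is
  defined directly is \<open>\<beta>\<close> at the second index \<open>j\<close> plus the number of loops, hence the shift
  of \<open>j\<close>.\<close>

definition beta :: "('v, 'e) mgraph \<Rightarrow> 'v \<Rightarrow> int \<Rightarrow> int \<Rightarrow> nat" where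
  "beta H q i j = card {(P, h).
     connected_partition H P \<and>
     int (card (verts (partition_graph H P))) = int (card (verts H)) - i \<and>
     int (card (edges (partition_graph H P))) =
       int (card (nonloops H)) - (j - int (card (loops H))) \<and>
     h \<in> acyclic_orientations (partition_graph H P) \<and>
     (\<exists>S\<in>P. q \<in> S \<and> sinks (partition_graph H P) h = {S})}"

lemma multiplicity_partition_graph:
  assumes "multigraph H" "partition_on (verts H) P" "A \<in> P" "B \<in> P" "A \<noteq> B"
  shows "multiplicity (partition_graph H P) A B = (\<Sum>u\<in>A. \<Sum>w\<in>B. multiplicity H u w)"
proof -
  have un: "\<Union>P = verts H" and disj: "\<And>S T. S \<in> P \<Longrightarrow> T \<in> P \<Longrightarrow> S \<noteq> T \<Longrightarrow> S \<inter> T = {}"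
    using assms(2) by (auto simp: partition_on_def disjoint_def)
  have fin: "finite A" "finite B" "finite (edges H)"
    using assms(1,3,4) un by (auto simp: multigraph_def intro: finite_subset)
  have AB: "A \<inter> B = {}" using disj assms by auto
  let ?E = "\<lambda>(u, w). {e \<in> edges H. ends H e = {u, w}}"
  let ?L = "{e \<in> edges (partition_graph H P). ends (partition_graph H P) e = {A, B}}"
  have "?L = (\<Union>x\<in>A \<times> B. ?E x)"
  proof (intro equalityI subsetI)
    fix e assume e: "e \<in> ?L"
    then have eH: "e \<in> edges H" and ends: "{S \<in> P. S \<inter> ends H e \<noteq> {}} = {A, B}"
      by (auto simp: partition_graph_def)
    have "A \<inter> ends H e \<noteq> {}" "B \<inter> ends H e \<noteq> {}" using ends by auto
    then obtain u w where uw: "u \<in> A" "u \<in> ends H e" "w \<in> B" "w \<in> ends H e" by auto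
    then have "u \<noteq> w" using AB by auto
    have "card (ends H e) = 1 \<or> card (ends H e) = 2" using assms(1) eH by (auto simp: multigraph_def)
    then have ends_uw: "ends H e = {u, w}"
    proof
      assume "card (ends H e) = 1"
      then obtain x where "ends H e = {x}" by (rule card_1_singletonE)
      then show ?thesis using uw \<open>u \<noteq> w\<close> by simp
    next
      assume "card (ends H e) = 2"
      then show ?thesis
        using uw \<open>u \<noteq> w\<close> card_subset_eq[of "ends H e" "{u, w}"]
        by (simp add: card_ge_0_finite)
    qed
    then show "e \<in> (\<Union>x\<in>A \<times> B. ?E x)"
      using eH uw(1,3) by (intro UN_I[of "(u, w)"]) simp_all
  next
    fix e assume "e \<in> (\<Union>x\<in>A \<times> B. ?E x)"
    then obtain u w where uw: "u \<in> A" "w \<in> B" "e \<in> edges H" "ends H e = {u, w}" by auto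
    have 1: "S = A" if "S \<in> P" "u \<in> S" for S using disj[OF that(1) assms(3)] that uw by auto
    have 2: "S = B" if "S \<in> P" "w \<in> S" for S using disj[OF that(1) assms(4)] that uw by auto
    have "{S \<in> P. S \<inter> {u, w} \<noteq> {}} = {A, B}" using 1 2 assms(3,4) uw(1,2) by blast
    moreover have "\<not> (\<exists>S\<in>P. {u, w} \<subseteq> S)" using 1 2 assms(5) by blast
    ultimately show "e \<in> ?L" using uw by (simp add: partition_graph_def)
  qed
  moreover have "card (\<Union>x\<in>A \<times> B. ?E x) = (\<Sum>x\<in>A \<times> B. card (?E x))"
    by (rule card_UN_disjoint) (use fin AB in \<open>auto simp: doubleton_eq_iff\<close>)
  ultimately show ?thesis
    by (simp add: multiplicity_def sum.cartesian_product case_prod_unfold)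
qed

end

(* A connected loopless multigraph has an acyclic orientation with unique sink at any given vertex,
   so each vanishing beta of G/e says that G has no connected partition, with v1 and v2 in the same
   part, with the corresponding numbers of parts and of edges between parts. Hence only partitions
   that separate v1 and v2 contribute to either side. If in such a partition e were the only edge
   between its two parts, joining them would give a forbidden partition with one part and one edge
   less. So e has a parallel edge in the partition graph, which then has as many acyclic
   orientations with as without e. *)

theory Submission
  imports Defs
begin

section \<open>Acyclic orientations with a unique sink\<close>

text \<open>The two sides may be computed with different fixed vertices \<open>q1\<close> and
  \<open>q2\<close>, so a term-by-term comparison needs the count of orientations to be independent
  of the sink. This is proved for a single multigraph by an explicit, invertible reversal of arcs.
  The index pairs arise as follows. Put r = n - i and s = |E| - j for \<open>G\<close>. A partition
  with \<open>v1\<close> and \<open>v2\<close> in one part has the same numbers of parts and of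
  crossing edges in \<open>G/e\<close>, which has one vertex and one edge less, so both of its
  indices drop by one. Type (r, s), counted for \<open>G\<close>, therefore sits at (i-1, j-1); type
  (r, s-1), counted after deletion of \<open>e\<close>, at (i-1, j); and type (r-1, s-1), produced
  by joining two parts, at (i, j).\<close>

definition unique_sink_orientations :: "('v, 'e) mgraph \<Rightarrow> 'v \<Rightarrow> ('e \<Rightarrow> 'v) set" where
  "unique_sink_orientations K u = {h \<in> acyclic_orientations K. sinks K h = {u}}"

lemma multigraph_finite:
  assumes "multigraph K"
  shows "finite (verts K)" "finite (edges K)"
  using assms by (auto simp: multigraph_def)

lemma multigraph_ends:
  assumes "multigraph K" "x \<in> edges K"
  obtains a b where "ends K x = {a, b}" "a \<in> verts K" "b \<in> verts K"
proof -
  have 1: "ends K x \<subseteq> verts K" "card (ends K x) = 1 \<or> card (ends K x) = 2"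
    using assms by (auto simp: multigraph_def)
  from 1(2) obtain a b where "ends K x = {a, b}"
    by (metis card_1_singletonE card_2_iff insert_absorb2)
  with 1(1) that show ?thesis by auto
qed

lemma acyclic_orientations_undefined:
  assumes "h \<in> acyclic_orientations K" "x \<notin> edges K"
  shows "h x = undefined"
  using assms PiE_arb[of h "edges K" "ends K" x]
  by (simp add: acyclic_orientations_def orientations_def)

lemma oriented_arcsE:
  assumes "(a, b) \<in> oriented_arcs K h"
  obtains x where "x \<in> edges K" "ends K x = {a, b}" "h x = b"
  using assms by (auto simp: oriented_arcs_def)

lemma oriented_arcs_verts:
  assumes "multigraph K"
  shows "oriented_arcs K h \<subseteq> verts K \<times> verts K"
  using assms by (fastforce simp: oriented_arcs_def multigraph_def)

lemma finite_acyclic_orientations: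
  assumes "multigraph K"
  shows "finite (acyclic_orientations K)"
proof -
  have "finite (orientations K)"
    unfolding orientations_def
    by (rule finite_PiE) (use assms in \<open>auto simp: multigraph_def intro: finite_subset\<close>)
  then show ?thesis by (simp add: acyclic_orientations_def)
qed

text \<open>A directed walk in a finite acyclic digraph can be prolonged until it meets a sink, and
  \<open>u\<close> is the only one. The induction uses that the converse of a finite acyclic
  relation is well-founded.\<close>

lemma reaches_unique_sink:
  assumes K: "multigraph K" and h: "h \<in> unique_sink_orientations K u" and v: "v \<in> verts K"
  shows "(v, u) \<in> (oriented_arcs K h)\<^sup>*"
proof -
  let ?R = "oriented_arcs K h"
  have "finite ?R"
    using oriented_arcs_verts[OF K] multigraph_finite[OF K] by (meson finite_SigmaI finite_subset)
  moreover have "acyclic ?R"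
    using h by (simp add: unique_sink_orientations_def acyclic_orientations_def)
  ultimately have "wf (?R\<inverse>)" by (simp add: finite_acyclic_wf_converse)
  then show ?thesis using v
  proof (induction v)
    case (less v)
    show ?case
    proof (cases "v \<in> sinks K h")
      case True
      then show ?thesis using h by (simp add: unique_sink_orientations_def)
    next
      case False
      then obtain w where w: "(v, w) \<in> ?R" using less.prems by (auto simp: sinks_def)
      then have "w \<in> verts K" using oriented_arcs_verts[OF K] by auto
      then have "(w, u) \<in> ?R\<^sup>*" using less.IH w by simp
      then show ?thesis using w by (rule converse_rtrancl_into_rtrancl[rotated])
    qed
  qed
qed

section \<open>Reversing arcs inside a set of vertices\<close>

definition flip :: "('v, 'e) mgraph \<Rightarrow> 'v set \<Rightarrow> ('e \<Rightarrow> 'v) \<Rightarrow> 'e \<Rightarrow> 'v" where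
  "flip K S h x = (if x \<in> edges K \<and> ends K x \<subseteq> S then the_elem (ends K x - {h x}) else h x)"

text \<open>A loop would be a cycle of length one. Hence every edge has exactly one end besides its
  head, which is what makes \<open>the_elem\<close> in \<open>flip\<close> meaningful.\<close>

lemma acyclic_orientation_ends:
  assumes K: "multigraph K" and h: "h \<in> acyclic_orientations K" and x: "x \<in> edges K"
  obtains a where "ends K x = {a, h x}" "a \<noteq> h x"
proof -
  obtain a b where ab: "ends K x = {a, b}" using multigraph_ends[OF K x] by metis
  have hx: "h x \<in> ends K x"
    using h x by (auto simp: acyclic_orientations_def orientations_def)
  have "a \<noteq> b"
  proof
    assume "a = b"
    then have "(a, a) \<in> oriented_arcs K h" using ab hx x by (auto simp: oriented_arcs_def)
    then show False using h by (auto simp: acyclic_orientations_def acyclic_def)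
  qed
  then show ?thesis using that[of a] that[of b] ab hx by auto
qed

lemma flip_value:
  assumes "x \<in> edges K" "ends K x = {a, h x}" "a \<noteq> h x"
  shows "flip K S h x = (if {a, h x} \<subseteq> S then a else h x)"
proof -
  have "ends K x - {h x} = {a}" using assms by auto
  then show ?thesis using assms by (simp add: flip_def)
qed

text \<open>Which edges are reversed depends on \<open>S\<close> alone and not on the orientation,
  so the second application reverses the same edges back.\<close>

lemma flip_flip:
  assumes K: "multigraph K" and h: "h \<in> acyclic_orientations K"
  shows "flip K S (flip K S h) = h"
proof
  fix x
  show "flip K S (flip K S h) x = h x"
  proof (cases "x \<in> edges K")
    case True
    obtain a where a: "ends K x = {a, h x}" "a \<noteq> h x"
      using acyclic_orientation_ends[OF K h True] .
    have 1: "flip K S h x = (if {a, h x} \<subseteq> S then a else h x)" by (rule flip_value[of x K a h S]) (use True a in auto)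
    show ?thesis
    proof (cases "{a, h x} \<subseteq> S")
      case T: True
      then have "flip K S h x = a" using 1 by simp
      then show ?thesis
        using flip_value[of x K "h x" "flip K S h" S] True a T by (simp add: insert_commute)
    next
      case False
      then have "\<not> ends K x \<subseteq> S" using a(1) by simp
      then show ?thesis by (simp add: flip_def)
    qed
  qed (simp add: flip_def)
qed

lemma oriented_arcs_flip:
  assumes K: "multigraph K" and h: "h \<in> acyclic_orientations K"
  shows "(a, b) \<in> oriented_arcs K (flip K S h) \<longleftrightarrow>
    (if a \<in> S \<and> b \<in> S then (b, a) \<in> oriented_arcs K h else (a, b) \<in> oriented_arcs K h)"
proof -
  have *: "x \<in> edges K \<and> ends K x = {a, b} \<and> flip K S h x = b \<longleftrightarrow>
      x \<in> edges K \<and> ends K x = {a, b} \<and> h x = (if a \<in> S \<and> b \<in> S then a else b)" for x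
  proof (cases "x \<in> edges K")
    case True
    obtain c where c: "ends K x = {c, h x}" "c \<noteq> h x"
      using acyclic_orientation_ends[OF K h True] .
    have "flip K S h x = (if {c, h x} \<subseteq> S then c else h x)"
      by (rule flip_value[of x K c h S]) (use True c in auto)
    then show ?thesis using c by (auto simp: doubleton_eq_iff)
  qed simp
  show ?thesis
    unfolding oriented_arcs_def mem_Collect_eq prod.case Bex_def *
    by (auto simp: insert_commute)
qed

text \<open>Moving the sink from \<open>u\<close> to \<open>w\<close>: everything reachable from \<open>w\<close> is exactly what becomes
  reachable from \<open>u\<close> after reversing the arcs inside this set, so the move can be undone.\<close>

lemma flip_reachable:
  assumes K: "multigraph K" and h: "h \<in> unique_sink_orientations K u" and w: "w \<in> verts K"
    and S: "S = (oriented_arcs K h)\<^sup>* `` {w}"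
  shows "flip K S h \<in> unique_sink_orientations K w"
    and "(oriented_arcs K (flip K S h))\<^sup>* `` {u} = S"
proof -
  let ?R = "oriented_arcs K h" and ?R' = "oriented_arcs K (flip K S h)"
  have hA: "h \<in> acyclic_orientations K" and hs: "sinks K h = {u}"
    using h by (auto simp: unique_sink_orientations_def)
  have ac: "acyclic ?R" using hA by (simp add: acyclic_orientations_def)
  note R' = oriented_arcs_flip[OF K hA]
  have closed: "b \<in> S" if "(a, b) \<in> ?R" "a \<in> S" for a b
    using that by (auto simp: S intro: rtrancl_into_rtrancl)
  \<comment> \<open>No arc leaves \<open>S\<close> in the old orientation. Arcs between
    \<open>S\<close> and its complement are untouched, so this remains true, and new arcs that start
    in \<open>S\<close> are reversed old ones.\<close>
  have closed': "b \<in> S \<and> (b, a) \<in> ?R" if "(a, b) \<in> ?R'" "a \<in> S" for a b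
    using that closed by (auto simp: R' split: if_splits)
  have wS: "w \<in> S" by (simp add: S)
  have SV: "S \<subseteq> verts K"
  proof
    fix v assume "v \<in> S"
    then have "(w, v) \<in> ?R\<^sup>*" by (simp add: S)
    then show "v \<in> verts K" using w oriented_arcs_verts[OF K] by (induction) auto
  qed
  \<comment> \<open>A new path that starts in \<open>S\<close> stays there and is an old path read
    backwards; a new path that ends outside \<open>S\<close> never met \<open>S\<close> and is an
    old path. Either way a new cycle yields an old one.\<close>
  have toin: "(y, x) \<in> ?R\<^sup>+ \<and> y \<in> S" if "(x, y) \<in> ?R'\<^sup>+" "x \<in> S" for x y
    using that
  proof (induction rule: trancl_induct)
    case (base y)
    then show ?case using closed' by auto
  next
    case (step y z)
    then show ?case using closed'[of y z] by (auto intro: trancl_into_trancl2)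
  qed
  have toout: "(x, y) \<in> ?R\<^sup>+" if "(x, y) \<in> ?R'\<^sup>+" "y \<notin> S" for x y
    using that
  proof (induction rule: trancl_induct)
    case (base y)
    then show ?case by (auto simp: R')
  next
    case (step y z)
    then have "y \<notin> S" using closed'[of y z] by blast
    then have "(x, y) \<in> ?R\<^sup>+" "(y, z) \<in> ?R" using step R'[of y z S] by auto
    then show ?case by (rule trancl_into_trancl)
  qed
  have ac': "acyclic ?R'"
    unfolding acyclic_def
  proof (intro allI notI)
    fix x assume "(x, x) \<in> ?R'\<^sup>+"
    then have "(x, x) \<in> ?R\<^sup>+" using toin[of x x] toout[of x x] by blast
    then show False using ac by (simp add: acyclic_def)
  qed
  have "flip K S h \<in> orientations K"
  proof -
    have "flip K S h x \<in> ends K x" if x: "x \<in> edges K" for x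
    proof -
      obtain c where c: "ends K x = {c, h x}" "c \<noteq> h x"
        using acyclic_orientation_ends[OF K hA x] .
      then show ?thesis using flip_value[of x K c h S] x by auto
    qed
    moreover have "flip K S h x = undefined" if "x \<notin> edges K" for x
      using acyclic_orientations_undefined[OF hA that] that by (simp add: flip_def)
    ultimately show ?thesis unfolding orientations_def by (intro PiE_I)
  qed
  moreover have "sinks K (flip K S h) = {w}"
  proof -
    \<comment> \<open>A new arc from \<open>w\<close> to \<open>b\<close> reverses an old arc from
      \<open>b\<close> to \<open>w\<close>; as \<open>b\<close> is reachable from \<open>w\<close>,
      this closes an old cycle.\<close>
    have "(w, b) \<notin> ?R'" for b
    proof
      assume "(w, b) \<in> ?R'"
      then have "b \<in> S" "(b, w) \<in> ?R" using closed' wS by auto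
      then have "(w, w) \<in> ?R\<^sup>+" by (auto simp: S intro: rtrancl_into_trancl1)
      then show False using ac by (auto simp: acyclic_def)
    qed
    \<comment> \<open>Inside \<open>S\<close>, the last arc of an old path from \<open>w\<close> to
      \<open>v\<close> now leaves \<open>v\<close>. Outside \<open>S\<close>, the outgoing arcs are
      unchanged, and they exist because the old sink \<open>u\<close> lies in
      \<open>S\<close>.\<close>
    moreover have "\<exists>b. (v, b) \<in> ?R'" if v: "v \<in> verts K" "v \<noteq> w" for v
    proof (cases "v \<in> S")
      case True
      then have "(w, v) \<in> ?R\<^sup>*" by (simp add: S)
      then obtain y where y: "(w, y) \<in> ?R\<^sup>*" "(y, v) \<in> ?R" using v(2) by (auto elim: rtranclE)
      then have "y \<in> S" by (simp add: S)
      then show ?thesis using R'[of v y S] y(2) True by auto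
    next
      case False
      have "u \<in> S" using reaches_unique_sink[OF K h w] by (simp add: S)
      then have "v \<notin> sinks K h" using hs False by auto
      then obtain b where "(v, b) \<in> ?R" using v by (auto simp: sinks_def)
      then show ?thesis using R'[of v b S] False by auto
    qed
    ultimately show ?thesis using w by (auto simp: sinks_def)
  qed
  ultimately show "flip K S h \<in> unique_sink_orientations K w"
    using ac' by (simp add: unique_sink_orientations_def acyclic_orientations_def)
  show "?R'\<^sup>* `` {u} = S"
  proof (intro equalityI subsetI)
    fix v assume "v \<in> ?R'\<^sup>* `` {u}"
    then have "(u, v) \<in> ?R'\<^sup>*" by simp
    moreover have "u \<in> S" using reaches_unique_sink[OF K h w] by (simp add: S)
    ultimately show "v \<in> S" using closed' by (induction) auto
  next
    \<comment> \<open>An old path from \<open>v\<close> to \<open>u\<close> stays in the closed set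
      \<open>S\<close>, so all its arcs are reversed and it becomes a path from \<open>u\<close> to
      \<open>v\<close>.\<close>
    fix v assume v: "v \<in> S"
    then have "(v, u) \<in> ?R\<^sup>*" using reaches_unique_sink[OF K h] SV by auto
    then have "(u, v) \<in> ?R'\<^sup>*" using v
    proof (induction rule: converse_rtrancl_induct)
      case (step y z)
      then have "z \<in> S" using closed by auto
      then show ?case using step R'[of z y S] by (auto intro: rtrancl_into_rtrancl)
    qed simp
    then show "v \<in> ?R'\<^sup>* `` {u}" by simp
  qed
qed

text \<open>The set \<open>S\<close> used to move the sink can be read off from the result as what
  is reachable from the old sink. Reversing inside it once more restores the orientation, so the
  move is injective; exchanging \<open>u\<close> and \<open>w\<close> gives the other
  inequality.\<close>

lemma card_unique_sink_orientations_eq: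
  assumes K: "multigraph K" and "u \<in> verts K" "w \<in> verts K"
  shows "card (unique_sink_orientations K u) = card (unique_sink_orientations K w)"
proof -
  have fin: "finite (unique_sink_orientations K v)" for v
    using finite_acyclic_orientations[OF K] by (simp add: unique_sink_orientations_def)
  have le: "card (unique_sink_orientations K u) \<le> card (unique_sink_orientations K w)"
    if w: "w \<in> verts K" for u w
  proof (rule card_inj_on_le)
    let ?S = "\<lambda>v h. (oriented_arcs K h)\<^sup>* `` {v}"
    let ?f = "\<lambda>v h. flip K (?S v h) h"
    show "?f w ` unique_sink_orientations K u \<subseteq> unique_sink_orientations K w"
      using flip_reachable(1)[OF K _ w refl] by blast
    have "?f u (?f w h) = h" if h: "h \<in> unique_sink_orientations K u" for h
    proof -
      have "?S u (?f w h) = ?S w h" by (rule flip_reachable(2)[OF K h w refl])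
      then show ?thesis using flip_flip[OF K] h by (simp add: unique_sink_orientations_def)
    qed
    then show "inj_on (?f w) (unique_sink_orientations K u)" by (rule inj_on_inverseI[where g = "?f u"])
  qed (rule fin)
  show ?thesis using le[OF assms(2)] le[OF assms(3)] by (rule antisym[rotated])
qed

text \<open>Every edge is directed towards its end nearer to \<open>u\<close>, as in breadth-first
  search. The injective numbering \<open>g\<close> breaks ties between ends at equal distance, so
  heads are smaller than tails in the well-founded order \<open>L\<close>.\<close>

lemma unique_sink_orientations_nonempty:
  assumes K: "multigraph K" and conn: "connected_graph K"
    and nl: "\<And>x. x \<in> edges K \<Longrightarrow> card (ends K x) = 2" and u: "u \<in> verts K"
  shows "unique_sink_orientations K u \<noteq> {}"
proof -
  obtain g :: "_ \<Rightarrow> nat" where g: "inj_on g (verts K)"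
    using multigraph_finite(1)[OF K] finite_imp_inj_to_nat_seg by blast
  define d where "d v = (LEAST n. (v, u) \<in> adjacency K ^^ n)" for v
  define L where "L = inv_image (less_than <*lex*> less_than) (\<lambda>v. (d v, g v))"
  have wfL: "wf L" unfolding L_def by (intro wf_inv_image wf_lex_prod wf_less_than)
  have total: "(a, b) \<in> L \<or> (b, a) \<in> L" if "a \<in> verts K" "b \<in> verts K" "a \<noteq> b" for a b
    using g that unfolding L_def by (auto simp: inj_on_def) (metis linorder_less_linear)
  define h where "h = restrict (\<lambda>x. SOME b. \<exists>a. ends K x = {a, b} \<and> (b, a) \<in> L) (edges K)"
  have h: "\<exists>a. ends K x = {a, h x} \<and> (h x, a) \<in> L" if x: "x \<in> edges K" for x
  proof -
    obtain a b where ab: "ends K x = {a, b}" "a \<in> verts K" "b \<in> verts K"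
      using multigraph_ends[OF K x] by metis
    then have "a \<noteq> b" using nl[OF x] by auto
    then have "\<exists>b a. ends K x = {a, b} \<and> (b, a) \<in> L"
      using total[OF ab(2,3)] ab(1) by (metis insert_commute)
    from someI_ex[OF this] show ?thesis using x by (simp add: h_def)
  qed
  have arcs: "(b, a) \<in> L" if "(a, b) \<in> oriented_arcs K h" for a b
    using that h by (fastforce elim!: oriented_arcsE simp: doubleton_eq_iff)
  have "h \<in> orientations K"
    unfolding orientations_def by (intro PiE_I) (use h in \<open>auto simp: h_def\<close>)
  moreover have "acyclic (oriented_arcs K h)"
  proof -
    have "oriented_arcs K h \<subseteq> L\<inverse>" using arcs by auto
    then show ?thesis using wfL by (meson acyclic_converse acyclic_subset wf_acyclic)
  qed
  moreover have "sinks K h = {u}"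
  proof -
    have reach: "(v, u) \<in> adjacency K ^^ d v" if "v \<in> verts K" for v
    proof -
      have "(v, u) \<in> (adjacency K)\<^sup>*" using conn that u by (simp add: connected_graph_def)
      then have "\<exists>n. (v, u) \<in> adjacency K ^^ n" by (auto simp: rtrancl_power)
      then show ?thesis unfolding d_def by (rule LeastI_ex)
    qed
    \<comment> \<open>The next vertex on a shortest walk from \<open>v\<close> to \<open>u\<close>
      is strictly nearer to \<open>u\<close>, so the edge to it leaves \<open>v\<close>.\<close>
    have less: "\<exists>b. (v, b) \<in> oriented_arcs K h" if v: "v \<in> verts K" "v \<noteq> u" for v
    proof -
      obtain n where n: "d v = Suc n" using reach[OF v(1)] v(2) by (cases "d v") auto
      then obtain b where b: "(v, b) \<in> adjacency K" "(b, u) \<in> adjacency K ^^ n"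
        using reach[OF v(1)] relpow_Suc_E2[of v u n "adjacency K"] by metis
      then have "d b \<le> n" unfolding d_def by (simp add: Least_le)
      then have vb: "(v, b) \<notin> L" using n by (auto simp: L_def)
      obtain x where x: "x \<in> edges K" "ends K x = {v, b}" using b by (auto simp: adjacency_def)
      then have "h x = b" using h[OF x(1)] vb by (auto simp: doubleton_eq_iff)
      then show ?thesis using x by (auto simp: oriented_arcs_def)
    qed
    \<comment> \<open>The vertices other than \<open>u\<close> are not sinks, so it is enough that
      some sink exists; an \<open>L\<close>-minimal vertex is one.\<close>
    have "\<exists>v \<in> verts K. \<forall>b. (v, b) \<notin> oriented_arcs K h"
    proof -
      obtain v where v: "v \<in> verts K" "\<And>b. (b, v) \<in> L \<Longrightarrow> b \<notin> verts K"
        using wfE_min[OF wfL u] by metis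
      moreover have "(v, b) \<notin> oriented_arcs K h" for b
        using arcs[of v b] v(2)[of b] oriented_arcs_verts[OF K] by blast
      ultimately show ?thesis by blast
    qed
    then show ?thesis using less u by (fastforce simp: sinks_def)
  qed
  ultimately show ?thesis by (auto simp: unique_sink_orientations_def acyclic_orientations_def)
qed

section \<open>Connected partitions\<close>

text \<open>Walks are mapped edge by edge. Only a walk between the images of adjacent vertices is
  required, since an edge may collapse to a point. The map will be \<open>part_of P\<close>,
  \<open>merge v1 v2\<close>, or \<open>id\<close> when a deleted edge is restored.\<close>

lemma connected_graph_image:
  assumes "connected_graph H" "verts H' = f ` verts H"
    and "\<And>a b. (a, b) \<in> adjacency H \<Longrightarrow> a \<in> verts H \<Longrightarrow> b \<in> verts H \<Longrightarrow> (f a, f b) \<in> (adjacency H')\<^sup>*"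
    and "\<And>x. x \<in> edges H \<Longrightarrow> ends H x \<subseteq> verts H"
  shows "connected_graph H'"
proof -
  have "(f a, f b) \<in> (adjacency H')\<^sup>*" if "(a, b) \<in> (adjacency H)\<^sup>*" for a b
    using that
  proof induction
    case (step y z)
    then have "y \<in> verts H" "z \<in> verts H" using assms(4) by (auto simp: adjacency_def)
    with step assms(3) show ?case by (meson rtrancl_trans)
  qed simp
  then show ?thesis using assms(1,2) by (auto simp: connected_graph_def)
qed

lemma adjacency_induced_subgraph:
  "(a, b) \<in> adjacency (induced_subgraph H S) \<longleftrightarrow> (a, b) \<in> adjacency H \<and> a \<in> S \<and> b \<in> S"
  by (auto simp: adjacency_def induced_subgraph_def)

lemma partition_on_part_unique:
  assumes "partition_on V P" "S \<in> P" "T \<in> P" "a \<in> S" "a \<in> T"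
  shows "S = T"
  using assms by (auto simp: partition_on_def disjoint_def)

definition part_of :: "'a set set \<Rightarrow> 'a \<Rightarrow> 'a set" where
  "part_of P v = (THE S. S \<in> P \<and> v \<in> S)"

lemma part_of_eq:
  assumes P: "partition_on V P" and S: "S \<in> P" "v \<in> S"
  shows "part_of P v = S"
  unfolding part_of_def
proof (rule the_equality)
  show "T = S" if "T \<in> P \<and> v \<in> T" for T
    using partition_on_part_unique[OF P, of T S v] that S by simp
qed (use S in simp)

lemma part_of_in:
  assumes P: "partition_on V P" and v: "v \<in> V"
  shows "part_of P v \<in> P"
proof -
  obtain S where "S \<in> P" "v \<in> S" using v partition_onD1[OF P] by auto
  then show ?thesis using part_of_eq[OF P] by simp
qed

lemma ends_partition_graph:
  assumes P: "partition_on (verts H) P" and "S \<in> P" "T \<in> P" "a \<in> S" "b \<in> T" "ends H x = {a, b}"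
  shows "ends (partition_graph H P) x = {S, T}"
  using assms partition_on_part_unique[OF P] by (auto simp: partition_graph_def)

lemma partition_graph_edgeE:
  assumes H: "multigraph H" and P: "partition_on (verts H) P"
    and x: "x \<in> edges (partition_graph H P)"
  obtains a b S T where "x \<in> edges H" "ends H x = {a, b}" "S \<in> P" "T \<in> P" "a \<in> S" "b \<in> T" "S \<noteq> T"
proof -
  have xH: "x \<in> edges H" and nx: "\<And>S. S \<in> P \<Longrightarrow> \<not> ends H x \<subseteq> S"
    using x by (auto simp: partition_graph_def)
  obtain a b where ab: "ends H x = {a, b}" "a \<in> verts H" "b \<in> verts H"
    using multigraph_ends[OF H xH] by metis
  then obtain S T where "S \<in> P" "T \<in> P" "a \<in> S" "b \<in> T"
    using partition_onD1[OF P] by auto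
  with that[OF xH ab(1) this] nx[of S] ab(1) show ?thesis by auto
qed

lemma partition_graph_edgeI:
  assumes P: "partition_on (verts H) P" and "S \<in> P" "T \<in> P" "a \<in> S" "b \<in> T" "S \<noteq> T"
    and "x \<in> edges H" "ends H x = {a, b}"
  shows "x \<in> edges (partition_graph H P)"
proof -
  have "\<not> {a, b} \<subseteq> X" if "X \<in> P" for X
    using partition_on_part_unique[OF P that] assms(2-6) by blast
  then show ?thesis using assms(7,8) by (simp add: partition_graph_def)
qed

lemma card_ends_partition_graph:
  assumes H: "multigraph H" and P: "partition_on (verts H) P"
    and x: "x \<in> edges (partition_graph H P)"
  shows "card (ends (partition_graph H P) x) = 2"
proof -
  obtain a b S T where "ends H x = {a, b}" "S \<in> P" "T \<in> P" "a \<in> S" "b \<in> T" "S \<noteq> T"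
    using partition_graph_edgeE[OF H P x] .
  then show ?thesis using ends_partition_graph[OF P, of S T a b x] by simp
qed

lemma verts_partition_graph: "verts (partition_graph H P) = P"
  by (simp add: partition_graph_def)

lemma multigraph_partition_graph:
  assumes H: "multigraph H" and P: "partition_on (verts H) P"
  shows "multigraph (partition_graph H P)"
proof -
  have "finite P" using multigraph_finite(1)[OF H] P by (rule finite_elements)
  moreover have "finite (edges (partition_graph H P))"
    using multigraph_finite(2)[OF H] by (simp add: partition_graph_def)
  moreover have "ends (partition_graph H P) x \<subseteq> P" for x by (auto simp: partition_graph_def)
  ultimately show ?thesis using card_ends_partition_graph[OF H P]
    by (auto simp: multigraph_def partition_graph_def)
qed

lemma connected_partition_graph:
  assumes H: "multigraph H" and conn: "connected_graph H" and P: "partition_on (verts H) P"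
  shows "connected_graph (partition_graph H P)"
proof -
  have V: "verts (partition_graph H P) = part_of P ` verts H"
  proof -
    have "S \<in> part_of P ` verts H" if S: "S \<in> P" for S
    proof -
      obtain v where v: "v \<in> S" using partition_onD3[OF P] S by fastforce
      then have "v \<in> verts H" using partition_onD1[OF P] S by auto
      then show ?thesis using part_of_eq[OF P S v] by auto
    qed
    then show ?thesis using part_of_in[OF P] by (auto simp: partition_graph_def)
  qed
  show ?thesis
  proof (rule connected_graph_image[OF conn V])
    fix a b assume ab: "(a, b) \<in> adjacency H" "a \<in> verts H" "b \<in> verts H"
    then obtain S T where ST: "S \<in> P" "T \<in> P" "a \<in> S" "b \<in> T"
      using partition_onD1[OF P] by auto
    obtain x where x: "x \<in> edges H" "ends H x = {a, b}" using ab by (auto simp: adjacency_def)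
    have "(S, T) \<in> (adjacency (partition_graph H P))\<^sup>*"
    proof (cases "S = T")
      case False
      have "(S, T) \<in> adjacency (partition_graph H P)"
        unfolding adjacency_def mem_Collect_eq prod.case
        by (rule bexI[where x = x]) (rule ends_partition_graph[OF P ST x(2)],
            rule partition_graph_edgeI[OF P ST False x])
      then show ?thesis ..
    qed simp
    then show "(part_of P a, part_of P b) \<in> (adjacency (partition_graph H P))\<^sup>*"
      using part_of_eq[OF P] ST by simp
  next
    show "ends H x \<subseteq> verts H" if "x \<in> edges H" for x using H that by (auto simp: multigraph_def)
  qed
qed

section \<open>The numbers beta as sums over connected partitions\<close>

definition connected_partitions :: "('v, 'e) mgraph \<Rightarrow> int \<Rightarrow> int \<Rightarrow> 'v set set set" where
  "connected_partitions H r s = {P. connected_partition H P \<and>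
     int (card P) = r \<and> int (card (edges (partition_graph H P))) = s}"

lemma card_loops_nonloops:
  assumes "multigraph H"
  shows "card (loops H) + card (nonloops H) = card (edges H)"
proof -
  have "edges H = loops H \<union> nonloops H" "loops H \<inter> nonloops H = {}"
    using assms by (auto simp: multigraph_def loops_def nonloops_def)
  then show ?thesis using multigraph_finite(2)[OF assms] by (metis card_Un_disjoint finite_Un)
qed

lemma finite_connected_partitions:
  assumes "multigraph H"
  shows "finite (connected_partitions H r s)"
proof -
  have "connected_partitions H r s \<subseteq> Pow (Pow (verts H))"
    by (auto simp: connected_partitions_def connected_partition_def partition_on_def)
  then show ?thesis using multigraph_finite(1)[OF assms] by (meson finite_Pow_iff finite_subset)
qed

text \<open>Loops and non-loops together are all edges, so the loop shift turns the edge condition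
  into \<open>card (edges H) - j\<close>. Edges that contraction turns into loops then need no
  separate bookkeeping.\<close>

lemma beta_eq_sum:
  assumes H: "multigraph H" and q: "q \<in> verts H"
    and r: "r = int (card (verts H)) - i" and s: "s = int (card (edges H)) - j"
  shows "beta H q i j = (\<Sum>P\<in>connected_partitions H r s.
    card (unique_sink_orientations (partition_graph H P) (part_of P q)))"
proof -
  let ?A = "\<lambda>P. unique_sink_orientations (partition_graph H P) (part_of P q)"
  have part: "(\<exists>S\<in>P. q \<in> S \<and> X = {S}) \<longleftrightarrow> X = {part_of P q}"
    if "connected_partition H P" for P X
  proof -
    have P: "partition_on (verts H) P" using that by (simp add: connected_partition_def)
    obtain S where S: "S \<in> P" "q \<in> S" using q partition_onD1[OF P] by auto
    show ?thesis
    proof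
      assume "\<exists>S\<in>P. q \<in> S \<and> X = {S}"
      then show "X = {part_of P q}" using part_of_eq[OF P] by auto
    next
      assume "X = {part_of P q}"
      then show "\<exists>S\<in>P. q \<in> S \<and> X = {S}" using S part_of_eq[OF P S] by auto
    qed
  qed
  have nl: "int (card (nonloops H)) - (j - int (card (loops H))) = s"
    using card_loops_nonloops[OF H] s by linarith
  have "{(P, h). connected_partition H P \<and>
     int (card (verts (partition_graph H P))) = int (card (verts H)) - i \<and>
     int (card (edges (partition_graph H P))) =
       int (card (nonloops H)) - (j - int (card (loops H))) \<and>
     h \<in> acyclic_orientations (partition_graph H P) \<and>
     (\<exists>S\<in>P. q \<in> S \<and> sinks (partition_graph H P) h = {S})} = Sigma (connected_partitions H r s) ?A"
    (is "?B = _")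
  proof (intro set_eqI)
    fix x :: "'a set set \<times> ('b \<Rightarrow> 'a set)"
    obtain P h where x: "x = (P, h)" by (cases x)
    show "x \<in> ?B \<longleftrightarrow> x \<in> Sigma (connected_partitions H r s) ?A"
    proof (cases "connected_partition H P")
      case True
      show ?thesis
        unfolding x mem_Collect_eq prod.case part[OF True] nl mem_Sigma_iff
          connected_partitions_def unique_sink_orientations_def verts_partition_graph r
        by blast
    next
      case False
      then show ?thesis by (simp add: x connected_partitions_def)
    qed
  qed
  then have "beta H q i j = card (Sigma (connected_partitions H r s) ?A)"
    by (simp add: beta_def)
  also have "\<dots> = (\<Sum>P\<in>connected_partitions H r s. card (?A P))"
  proof (rule card_SigmaI[OF finite_connected_partitions[OF H]], intro ballI)
    fix P assume "P \<in> connected_partitions H r s"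
    then have "partition_on (verts H) P"
      by (simp add: connected_partitions_def connected_partition_def)
    then show "finite (?A P)"
      using finite_acyclic_orientations[OF multigraph_partition_graph[OF H]]
      by (simp add: unique_sink_orientations_def)
  qed
  finally show ?thesis .
qed

lemma beta_eq_0_imp_no_partition:
  assumes H: "multigraph H" and conn: "connected_graph H" and q: "q \<in> verts H"
    and beta: "beta H q i j = 0"
  shows "connected_partitions H (int (card (verts H)) - i) (int (card (edges H)) - j) = {}"
proof (rule ccontr)
  let ?C = "connected_partitions H (int (card (verts H)) - i) (int (card (edges H)) - j)"
  assume "?C \<noteq> {}"
  then obtain P where PC: "P \<in> ?C" by blast
  then have P: "partition_on (verts H) P"
    by (simp add: connected_partitions_def connected_partition_def)
  let ?K = "partition_graph H P" and ?S = "part_of P q"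
  have K: "multigraph ?K" by (rule multigraph_partition_graph[OF H P])
  have "unique_sink_orientations ?K ?S \<noteq> {}"
    by (rule unique_sink_orientations_nonempty[OF K connected_partition_graph[OF H conn P]
          card_ends_partition_graph[OF H P]])
       (use part_of_in[OF P q] in \<open>auto simp: partition_graph_def\<close>)
  moreover have "finite (unique_sink_orientations ?K ?S)"
    using finite_acyclic_orientations[OF K] by (simp add: unique_sink_orientations_def)
  moreover have "card (unique_sink_orientations ?K ?S) = 0"
    using beta[unfolded beta_eq_sum[OF H q refl refl]] finite_connected_partitions[OF H] PC by simp
  ultimately show False by simp
qed

section \<open>Deletion and contraction\<close>

lemma edges_delete_edge: "edges (delete_edge H e) = edges H - {e}"
  by (simp add: delete_edge_def)

lemma multigraph_delete_edge: "multigraph H \<Longrightarrow> multigraph (delete_edge H e)"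
  by (auto simp: multigraph_def delete_edge_def)

lemma merge_eq_iff:
  "merge v1 v2 a = merge v1 v2 b \<longleftrightarrow> a = b \<or> {a, b} \<subseteq> {v1, v2}"
  by (auto simp: merge_def)

lemma multigraph_contract_edge:
  assumes H: "multigraph H"
  shows "multigraph (contract_edge H e v1 v2)"
proof -
  let ?f = "merge v1 v2"
  have "?f ` ends H x \<subseteq> ?f ` verts H \<and> (card (?f ` ends H x) = 1 \<or> card (?f ` ends H x) = 2)"
    if x: "x \<in> edges H" for x
  proof -
    obtain a b where "ends H x = {a, b}" "a \<in> verts H" "b \<in> verts H"
      using multigraph_ends[OF H x] .
    then show ?thesis by (cases "?f a = ?f b") auto
  qed
  then show ?thesis
    using multigraph_finite[OF H] by (auto simp: multigraph_def contract_edge_def)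
qed

lemma adjacency_contract_edge:
  assumes "(a, b) \<in> adjacency H" "ends H e = {v1, v2}"
  shows "merge v1 v2 a = merge v1 v2 b \<or>
    (merge v1 v2 a, merge v1 v2 b) \<in> adjacency (contract_edge H e v1 v2)"
proof -
  obtain x where x: "x \<in> edges H" "ends H x = {a, b}" using assms(1) by (auto simp: adjacency_def)
  show ?thesis
  proof (cases "x = e")
    case True
    then show ?thesis using x assms(2) by (auto simp: merge_eq_iff)
  next
    case False
    then show ?thesis using x by (auto simp: adjacency_def contract_edge_def)
  qed
qed

lemma connected_contract_edge:
  assumes H: "multigraph H" and "connected_graph H" "ends H e = {v1, v2}"
  shows "connected_graph (contract_edge H e v1 v2)"
proof (rule connected_graph_image[OF assms(2), of _ "merge v1 v2"])
  show "(merge v1 v2 a, merge v1 v2 b) \<in> (adjacency (contract_edge H e v1 v2))\<^sup>*"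
    if "(a, b) \<in> adjacency H" for a b
    using adjacency_contract_edge[OF that assms(3)] by auto
  show "ends H x \<subseteq> verts H" if "x \<in> edges H" for x using H that by (auto simp: multigraph_def)
qed (simp add: contract_edge_def)

text \<open>The only two vertices that \<open>merge\<close> identifies lie in the same part. Each
  part is thus a full preimage of its image, so disjointness, the number of parts and the relation
  of lying inside a part all survive.\<close>

lemma connected_partition_contract_edge:
  assumes P: "connected_partition H P" and e: "ends H e = {v1, v2}"
    and A: "A \<in> P" "v1 \<in> A" "v2 \<in> A"
  defines "P' \<equiv> (`) (merge v1 v2) ` P"
  shows "connected_partition (contract_edge H e v1 v2) P'" "card P' = card P"
    "edges (partition_graph (contract_edge H e v1 v2) P') = edges (partition_graph H P)"
proof -
  let ?f = "merge v1 v2" and ?H = "contract_edge H e v1 v2"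
  have part: "partition_on (verts H) P" using P by (simp add: connected_partition_def)
  have sat: "?f a \<in> ?f ` S \<longleftrightarrow> a \<in> S" if "S \<in> P" for S a
    using partition_on_part_unique[OF part that A(1)] A
    by (auto simp: image_iff merge_eq_iff)
  have sub: "?f ` X \<subseteq> ?f ` S \<longleftrightarrow> X \<subseteq> S" if "S \<in> P" for S X
    using sat[OF that] by blast
  have inj: "inj_on ((`) ?f) P" using sub by (intro inj_onI) (metis order.eq_iff)
  then show "card P' = card P" unfolding P'_def by (rule card_image)
  have "partition_on (verts ?H) P'"
  proof (rule partition_onI)
    show "\<Union>P' = verts ?H" using partition_onD1[OF part] by (auto simp: P'_def contract_edge_def)
    show "{} \<notin> P'" using partition_onD3[OF part] by (auto simp: P'_def)
    show "disjnt p p'" if pp: "p \<in> P'" "p' \<in> P'" "p \<noteq> p'" for p p'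
    proof -
      obtain S T where ST: "S \<in> P" "T \<in> P" "p = ?f ` S" "p' = ?f ` T" using pp by (auto simp: P'_def)
      then have "S \<inter> T = {}" using partition_on_part_unique[OF part ST(1,2)] pp(3) by blast
      then show ?thesis using sat[OF ST(2)] ST(3,4) by (auto simp: disjnt_iff)
    qed
  qed
  moreover have "connected_graph (induced_subgraph ?H (?f ` S))" if S: "S \<in> P" for S
  proof (rule connected_graph_image[of "induced_subgraph H S" _ ?f])
    show "connected_graph (induced_subgraph H S)" using P S by (simp add: connected_partition_def)
    show "(?f a, ?f b) \<in> (adjacency (induced_subgraph ?H (?f ` S)))\<^sup>*"
      if "(a, b) \<in> adjacency (induced_subgraph H S)" for a b
      using that adjacency_contract_edge[of a b H e, OF _ e]
      by (fastforce simp: adjacency_induced_subgraph)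
  qed (auto simp: induced_subgraph_def)
  ultimately show "connected_partition ?H P'" by (auto simp: connected_partition_def P'_def)
  \<comment> \<open>The edge lost in the contraction lies inside \<open>A\<close>, so it was not a
    crossing edge.\<close>
  have "x \<noteq> e" if "\<not> (\<exists>S\<in>P. ends H x \<subseteq> S)" for x using that A e by auto
  moreover have "(\<exists>S\<in>P'. ?f ` ends H x \<subseteq> S) \<longleftrightarrow> (\<exists>S\<in>P. ends H x \<subseteq> S)" for x
    using sub by (simp add: P'_def)
  ultimately show "edges (partition_graph ?H P') = edges (partition_graph H P)"
    by (auto simp: partition_graph_def contract_edge_def)
qed

text \<open>The two subtractions of 1 account for the vertex \<open>v2\<close> and the edge
  \<open>e\<close> that contraction removes; \<open>i\<close> and \<open>j\<close> are indices for
  the contracted graph, while \<open>r\<close> and \<open>s\<close> are read in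
  \<open>G\<close>.\<close>

lemma beta_contract_edge_eq_0:
  assumes G: "multigraph G" "connected_graph G" "e \<in> edges G" "ends G e = {v1, v2}" "v1 \<noteq> v2"
    and q: "q \<in> verts (contract_edge G e v1 v2)"
    and beta: "beta (contract_edge G e v1 v2) q i j = 0"
    and P: "P \<in> connected_partitions G r s"
    and rs: "r = int (card (verts G)) - 1 - i" "s = int (card (edges G)) - 1 - j"
    and A: "A \<in> P"
  shows "\<not> (v1 \<in> A \<and> v2 \<in> A)"
proof
  assume vA: "v1 \<in> A \<and> v2 \<in> A"
  let ?H = "contract_edge G e v1 v2"
  have v: "v1 \<in> verts G" "v2 \<in> verts G" using G(1,3,4) by (auto simp: multigraph_def)
  have "verts ?H = verts G - {v2}"
    using v G(5) by (auto simp: contract_edge_def merge_def image_iff)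
  then have cv: "int (card (verts ?H)) = int (card (verts G)) - 1"
    using v multigraph_finite(1)[OF G(1)] card_Suc_Diff1[of "verts G" v2] by simp
  have ce: "int (card (edges ?H)) = int (card (edges G)) - 1"
    using G(3) multigraph_finite(2)[OF G(1)] card_Suc_Diff1[of "edges G" e]
    by (simp add: contract_edge_def)
  have "connected_partition G P" using P by (simp add: connected_partitions_def)
  from connected_partition_contract_edge[OF this G(4) A] vA P
  have "(`) (merge v1 v2) ` P \<in> connected_partitions ?H
      (int (card (verts ?H)) - i) (int (card (edges ?H)) - j)"
    by (simp add: connected_partitions_def cv ce rs)
  then show False
    using beta_eq_0_imp_no_partition[OF multigraph_contract_edge[OF G(1)]
        connected_contract_edge[OF G(1,2,4)] q beta] by simp
qed

text \<open>Any two vertices of the union are joined through \<open>v1\<close>, with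
  \<open>e\<close> as the passage between \<open>A\<close> and \<open>B\<close>. The crossing edges
  that disappear are those running between these two parts.\<close>

lemma connected_merge_parts:
  assumes P: "connected_partition H P" and A: "A \<in> P" and B: "B \<in> P" and "A \<noteq> B"
    and fin: "finite P"
    and e: "e \<in> edges H" "ends H e = {v1, v2}" "v1 \<in> A" "v2 \<in> B"
  defines "P' \<equiv> insert (A \<union> B) (P - {A, B})"
  shows "connected_partition H P'" "Suc (card P') = card P"
    "edges (partition_graph H P') = {x \<in> edges (partition_graph H P). \<not> ends H x \<subseteq> A \<union> B}"
proof -
  have part: "partition_on (verts H) P" using P by (simp add: connected_partition_def)
  note uniq = partition_on_part_unique[OF part]
  \<comment> \<open>Without this the union might coincide with a remaining part, and the number of
    parts would drop by two.\<close>
  have new: "A \<union> B \<notin> P - {A, B}" using uniq[OF _ A] e(3) by blast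
  have "card P = Suc (Suc (card (P - {A, B})))"
    using A B \<open>A \<noteq> B\<close> fin card_Diff_subset[of "{A, B}" P] card_mono[of P "{A, B}"] by simp
  then show "Suc (card P') = card P" using new fin by (simp add: P'_def)
  have "partition_on (verts H) P'"
  proof (rule partition_onI)
    show "\<Union>P' = verts H" using partition_onD1[OF part] A B by (auto simp: P'_def)
    show "{} \<notin> P'" using partition_onD3[OF part] e(3) by (auto simp: P'_def)
    show "disjnt p p'" if "p \<in> P'" "p' \<in> P'" "p \<noteq> p'" for p p'
      using that uniq A B unfolding P'_def disjnt_iff by blast
  qed
  moreover have "connected_graph (induced_subgraph H (A \<union> B))"
  proof -
    let ?R = "(adjacency (induced_subgraph H (A \<union> B)))\<^sup>*"
    have mono: "(a, b) \<in> ?R" if "S \<in> {A, B}" "a \<in> S" "b \<in> S" for S a b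
    proof -
      have "connected_graph (induced_subgraph H S)"
        using that(1) P A B by (auto simp: connected_partition_def)
      then have "(a, b) \<in> (adjacency (induced_subgraph H S))\<^sup>*"
        using that(2,3) by (simp add: connected_graph_def induced_subgraph_def)
      moreover have "adjacency (induced_subgraph H S) \<subseteq> adjacency (induced_subgraph H (A \<union> B))"
        using that(1) by (auto simp: adjacency_induced_subgraph)
      ultimately show ?thesis by (meson rtrancl_mono subsetD)
    qed
    have "(v1, v2) \<in> adjacency H" "(v2, v1) \<in> adjacency H"
      using e(1,2) by (auto simp: adjacency_def insert_commute)
    then have "(v1, v2) \<in> ?R" "(v2, v1) \<in> ?R"
      using e(3,4) by (auto simp: adjacency_induced_subgraph)
    then have "(a, v1) \<in> ?R \<and> (v1, a) \<in> ?R" if "a \<in> A \<union> B" for a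
      using that mono[of A a v1] mono[of A v1 a] mono[of B a v2] mono[of B v2 a] e(3,4)
      by (auto intro: rtrancl_trans)
    then show ?thesis using e(3)
      by (auto simp: connected_graph_def induced_subgraph_def intro: rtrancl_trans)
  qed
  ultimately show "connected_partition H P'" using P by (auto simp: connected_partition_def P'_def)
  show "edges (partition_graph H P') = {x \<in> edges (partition_graph H P). \<not> ends H x \<subseteq> A \<union> B}"
    using A B by (auto simp: partition_graph_def P'_def)
qed

section \<open>Deletion of an edge and orientations\<close>

lemma partition_graph_delete_edge:
  "partition_graph (delete_edge H e) P = delete_edge (partition_graph H P) e"
  by (auto simp: partition_graph_def delete_edge_def)

text \<open>Opposite heads on \<open>e\<close> and \<open>f\<close> would form a 2-cycle, so the
  head of \<open>e\<close> is dictated by that of \<open>f\<close>. Forgetting it and copying it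
  from \<open>f\<close> are inverse to each other, and neither changes the set of arcs.\<close>

lemma card_unique_sink_orientations_delete_parallel:
  assumes K: "multigraph K" and e: "e \<in> edges K" and f: "f \<in> edges K" "f \<noteq> e"
    and par: "ends K f = ends K e"
  shows "card (unique_sink_orientations (delete_edge K e) u) = card (unique_sink_orientations K u)"
proof -
  let ?K = "delete_edge K e"
  have same: "h e = h f" if h: "h \<in> acyclic_orientations K" for h
  proof (rule ccontr)
    assume ne: "h e \<noteq> h f"
    obtain a where a: "ends K e = {a, h e}" "a \<noteq> h e" using acyclic_orientation_ends[OF K h e] .
    obtain b where b: "ends K f = {b, h f}" "b \<noteq> h f" using acyclic_orientation_ends[OF K h f(1)] .
    have "(h f, h e) \<in> oriented_arcs K h" "(h e, h f) \<in> oriented_arcs K h"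
      using a b par ne e f by (auto simp: oriented_arcs_def doubleton_eq_iff)
    then have "(h e, h e) \<in> (oriented_arcs K h)\<^sup>+" by (meson trancl.simps)
    then show False using h by (simp add: acyclic_orientations_def acyclic_def)
  qed
  have arcs: "oriented_arcs ?K h = oriented_arcs K h'"
    if "\<And>x. x \<in> edges K - {e} \<Longrightarrow> h x = h' x" "h' e = h' f" for h h'
  proof (intro subset_antisym subrelI)
    fix a b assume "(a, b) \<in> oriented_arcs ?K h"
    then obtain x where "x \<in> edges K - {e}" "ends K x = {a, b}" "h x = b"
      by (auto simp: oriented_arcs_def delete_edge_def)
    then show "(a, b) \<in> oriented_arcs K h'" using that(1) by (auto simp: oriented_arcs_def)
  next
    fix a b assume "(a, b) \<in> oriented_arcs K h'"
    then obtain x where x: "x \<in> edges K" "ends K x = {a, b}" "h' x = b" by (rule oriented_arcsE)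
    \<comment> \<open>An arc witnessed by \<open>e\<close> is witnessed in the smaller graph by its
      parallel \<open>f\<close>.\<close>
    define y where "y = (if x = e then f else x)"
    have "y \<in> edges K - {e}" "ends K y = {a, b}" "h y = b"
      using x f par that(1)[of f] that(1)[of x] that(2) by (auto simp: y_def)
    then show "(a, b) \<in> oriented_arcs ?K h" by (auto simp: oriented_arcs_def delete_edge_def)
  qed
  have sinks: "sinks ?K h = sinks K h'" if "oriented_arcs ?K h = oriented_arcs K h'" for h h'
    using that by (simp add: sinks_def delete_edge_def)
  have PiE: "edges ?K = edges K - {e}" "ends ?K = ends K" by (simp_all add: delete_edge_def)
  have "bij_betw (\<lambda>h. restrict h (edges K - {e}))
    (unique_sink_orientations K u) (unique_sink_orientations ?K u)"
  proof (rule bij_betw_byWitness[where f' = "\<lambda>h. h(e := h f)"])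
    show "\<forall>h\<in>unique_sink_orientations K u. (restrict h (edges K - {e}))
        (e := restrict h (edges K - {e}) f) = h"
    proof
      fix h assume "h \<in> unique_sink_orientations K u"
      then have h: "h \<in> acyclic_orientations K" by (simp add: unique_sink_orientations_def)
      \<comment> \<open>Restriction resets the values off the edge set to \<open>undefined\<close>;
        the round trip is the identity because orientations are extensional.\<close>
      have "h x = undefined" if "x \<notin> edges K" for x
        by (rule acyclic_orientations_undefined[OF h that])
      then show "(restrict h (edges K - {e})) (e := restrict h (edges K - {e}) f) = h"
        using same[OF h] f by (auto simp: fun_eq_iff)
    qed
    show "\<forall>h\<in>unique_sink_orientations ?K u. restrict (h(e := h f)) (edges K - {e}) = h"
    proof
      fix h assume "h \<in> unique_sink_orientations ?K u"
      then have "h \<in> acyclic_orientations ?K" by (simp add: unique_sink_orientations_def)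
      from acyclic_orientations_undefined[OF this]
      have "h x = undefined" if "x \<notin> edges K - {e}" for x using that PiE by simp
      then show "restrict (h(e := h f)) (edges K - {e}) = h" by (auto simp: fun_eq_iff)
    qed
    show "(\<lambda>h. restrict h (edges K - {e})) ` unique_sink_orientations K u
        \<subseteq> unique_sink_orientations ?K u"
    proof (rule image_subsetI)
      fix h assume h: "h \<in> unique_sink_orientations K u"
      then have "h e = h f" using same by (simp add: unique_sink_orientations_def)
      then have a: "oriented_arcs ?K (restrict h (edges K - {e})) = oriented_arcs K h"
        by (intro arcs) auto
      show "restrict h (edges K - {e}) \<in> unique_sink_orientations ?K u"
        using h a sinks[OF a] PiE
        by (auto simp: unique_sink_orientations_def acyclic_orientations_def orientations_def)
    qed
    show "(\<lambda>h. h(e := h f)) ` unique_sink_orientations ?K u \<subseteq> unique_sink_orientations K u"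
    proof (rule image_subsetI)
      fix h assume h: "h \<in> unique_sink_orientations ?K u"
      have a: "oriented_arcs ?K h = oriented_arcs K (h(e := h f))"
        using f by (intro arcs) auto
      have "h \<in> (\<Pi>\<^sub>E x\<in>edges K - {e}. ends K x)"
        using h PiE
        by (simp add: unique_sink_orientations_def acyclic_orientations_def orientations_def)
      moreover from this have "h f \<in> ends K e" using f par by (metis DiffI PiE_mem singletonD)
      ultimately have "h(e := h f) \<in> orientations K"
        using e unfolding orientations_def by (auto simp: PiE_iff extensional_def)
      then show "h(e := h f) \<in> unique_sink_orientations K u"
        using h a sinks[OF a]
        by (auto simp: unique_sink_orientations_def acyclic_orientations_def)
    qed
  qed
  then show ?thesis by (simp add: bij_betw_same_card)
qed

lemma connected_partition_delete_edgeD: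
  assumes P: "connected_partition (delete_edge H e) P"
  shows "connected_partition H P"
proof -
  have "connected_graph (induced_subgraph H S)" if "S \<in> P" for S
  proof (rule connected_graph_image[of "induced_subgraph (delete_edge H e) S" _ id])
    show "connected_graph (induced_subgraph (delete_edge H e) S)"
      using P that by (simp add: connected_partition_def)
  qed (auto simp: induced_subgraph_def delete_edge_def adjacency_def)
  then show ?thesis using P by (simp add: connected_partition_def delete_edge_def)
qed

text \<open>No part contains both ends of \<open>e\<close>, so no induced subgraph loses an
  edge.\<close>

lemma connected_partition_delete_edgeI:
  assumes P: "connected_partition H P" and e: "\<And>S. S \<in> P \<Longrightarrow> \<not> ends H e \<subseteq> S"
  shows "connected_partition (delete_edge H e) P"
proof -
  have "induced_subgraph (delete_edge H e) S = induced_subgraph H S" if "S \<in> P" for S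
    using e[OF that] by (auto simp: induced_subgraph_def delete_edge_def)
  then show ?thesis using P by (simp add: connected_partition_def delete_edge_def)
qed

theorem theorem1p9:
  fixes G :: "('v, 'e) mgraph" and e :: 'e and v1 v2 q q1 q2 :: 'v and i j :: int
  assumes "multigraph G"
    and "connected_graph G"
    and "e \<in> edges G"
    and "ends G e = {v1, v2}"
    and "v1 \<noteq> v2"
    and "\<not> bridge G e"
    and "q \<in> verts (contract_edge G e v1 v2)"
    and "q1 \<in> verts G"
    and "q2 \<in> verts (delete_edge G e)"
    and "beta (contract_edge G e v1 v2) q i j = 0"
    and "beta (contract_edge G e v1 v2) q (i - 1) (j - 1) = 0"
    and "beta (contract_edge G e v1 v2) q (i - 1) j = 0"
    and "beta (contract_edge G e v1 v2) q (i - 2) (j - 1) = 0"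
  shows "beta G q1 i j = beta (delete_edge G e) q2 i j"
proof -
  note G = assms(1-5)
  let ?D = "delete_edge G e"
  define r where "r = int (card (verts G)) - i"
  define s where "s = int (card (edges G)) - j"
  have D: "multigraph ?D" by (rule multigraph_delete_edge[OF G(1)])
  have r': "r = int (card (verts ?D)) - i" by (simp add: r_def delete_edge_def)
  \<comment> \<open>At the same index \<open>j\<close>, the partition graphs of \<open>?D\<close>
    have one edge less than those of \<open>G\<close>, because \<open>?D\<close> has.\<close>
  have s': "s - 1 = int (card (edges ?D)) - j"
    using G(3) multigraph_finite(2)[OF G(1)] card_Suc_Diff1[of "edges G" e]
    by (simp add: s_def delete_edge_def)
  have no: "\<not> (v1 \<in> A \<and> v2 \<in> A)"
    if "A \<in> P" "P \<in> connected_partitions G r s \<union> connected_partitions G r (s - 1) \<union>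
      connected_partitions G (r - 1) (s - 1)" for A P
    using that(2)
  proof (elim UnE)
    assume "P \<in> connected_partitions G r s"
    then show ?thesis
      by (rule beta_contract_edge_eq_0[OF G assms(7,11)]) (use that(1) in \<open>simp_all add: r_def s_def\<close>)
  next
    assume "P \<in> connected_partitions G r (s - 1)"
    then show ?thesis
      by (rule beta_contract_edge_eq_0[OF G assms(7,12)]) (use that(1) in \<open>simp_all add: r_def s_def\<close>)
  next
    assume "P \<in> connected_partitions G (r - 1) (s - 1)"
    then show ?thesis
      by (rule beta_contract_edge_eq_0[OF G assms(7,10)]) (use that(1) in \<open>simp_all add: r_def s_def\<close>)
  qed
  have crossing: "e \<in> edges (partition_graph G P)" if "\<And>A. A \<in> P \<Longrightarrow> \<not> (v1 \<in> A \<and> v2 \<in> A)" for P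
    using that G(3,4) by (auto simp: partition_graph_def)
  have card_edges: "int (card (edges (partition_graph ?D P))) =
      int (card (edges (partition_graph G P))) - 1" if "e \<in> edges (partition_graph G P)" for P
  proof -
    have "finite (edges (partition_graph G P))"
      using multigraph_finite(2)[OF G(1)] by (simp add: partition_graph_def)
    then show ?thesis using that card_Suc_Diff1[of "edges (partition_graph G P)" e]
      by (simp add: partition_graph_delete_edge edges_delete_edge)
  qed
  have C: "connected_partitions ?D r (s - 1) = connected_partitions G r s"
  proof (intro equalityI subsetI)
    fix P assume P: "P \<in> connected_partitions ?D r (s - 1)"
    then have cP: "connected_partition G P"
      using connected_partition_delete_edgeD by (auto simp: connected_partitions_def)
    \<comment> \<open>If \<open>e\<close> lay inside a part, its deletion would not change the
      partition graph, and \<open>P\<close> would be a partition of \<open>G\<close> of the excluded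
      type (r, s-1) with \<open>v1\<close> and \<open>v2\<close> together.\<close>
    have "e \<in> edges (partition_graph G P)"
    proof (rule ccontr)
      assume ne: "e \<notin> edges (partition_graph G P)"
      then have "partition_graph ?D P = partition_graph G P"
        by (simp add: partition_graph_delete_edge) (simp add: delete_edge_def partition_graph_def)
      then have "P \<in> connected_partitions G r (s - 1)"
        using P cP by (simp add: connected_partitions_def)
      then show False using crossing[of P] no[of _ P] ne by blast
    qed
    then show "P \<in> connected_partitions G r s"
      using P cP card_edges[of P] by (simp add: connected_partitions_def)
  next
    fix P assume P: "P \<in> connected_partitions G r s"
    then have "e \<in> edges (partition_graph G P)" using crossing[of P] no[of _ P] by blast
    moreover have "connected_partition ?D P"
      using P no[of _ P] G(4)
      by (intro connected_partition_delete_edgeI) (auto simp: connected_partitions_def)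
    ultimately show "P \<in> connected_partitions ?D r (s - 1)"
      using P card_edges[of P] by (simp add: connected_partitions_def)
  qed
  have parallel: "\<exists>f. f \<in> edges (partition_graph G P) \<and> f \<noteq> e \<and>
      ends (partition_graph G P) f = ends (partition_graph G P) e"
    if P: "P \<in> connected_partitions G r s" for P
  proof (rule ccontr)
    assume np: "\<not> ?thesis"
    let ?K = "partition_graph G P"
    have cP: "connected_partition G P" using P by (simp add: connected_partitions_def)
    then have part: "partition_on (verts G) P" by (simp add: connected_partition_def)
    have v: "v1 \<in> verts G" "v2 \<in> verts G" using G(1,3,4) by (auto simp: multigraph_def)
    then obtain A B where AB: "A \<in> P" "B \<in> P" "v1 \<in> A" "v2 \<in> B"
      using partition_onD1[OF part] by auto
    have "A \<noteq> B" using no[OF AB(1)] P AB by auto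
    have finP: "finite P" using multigraph_finite(1)[OF G(1)] part by (rule finite_elements)
    let ?P = "insert (A \<union> B) (P - {A, B})"
    note m = connected_merge_parts[OF cP AB(1,2) \<open>A \<noteq> B\<close> finP G(3,4) AB(3,4)]
    have eK: "e \<in> edges ?K" using crossing[of P] no[of _ P] P by blast
    \<comment> \<open>Since \<open>e\<close> is assumed to be the only edge between \<open>A\<close>
      and \<open>B\<close>, joining them costs exactly one crossing edge.\<close>
    have "x \<in> edges (partition_graph G ?P) \<longleftrightarrow> x \<in> edges ?K - {e}" for x
    proof (cases "x \<in> edges ?K \<and> x \<noteq> e")
      case True
      then have xK: "x \<in> edges ?K" by simp
      obtain a b S T where x: "ends G x = {a, b}" "S \<in> P" "T \<in> P" "a \<in> S" "b \<in> T" "S \<noteq> T"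
        using partition_graph_edgeE[OF G(1) part xK] .
      have "{S, T} \<noteq> {A, B}"
        using np True ends_partition_graph[OF part x(2-5,1)]
          ends_partition_graph[OF part AB G(4)] by auto
      moreover have "S \<in> {A, B}" if "a \<in> A \<union> B"
        using that x(2,4) AB partition_on_part_unique[OF part] by blast
      moreover have "T \<in> {A, B}" if "b \<in> A \<union> B"
        using that x(3,5) AB partition_on_part_unique[OF part] by blast
      ultimately have "\<not> ends G x \<subseteq> A \<union> B" using x(1,6) by auto
      then show ?thesis using m(3) True by simp
    next
      case False
      then show ?thesis using m(3) AB G(4) by auto
    qed
    then have "edges (partition_graph G ?P) = edges ?K - {e}" by blast
    then have "int (card (edges (partition_graph G ?P))) = int (card (edges ?K)) - 1"
      using card_edges[OF eK] by (simp add: partition_graph_delete_edge edges_delete_edge)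
    then have "?P \<in> connected_partitions G (r - 1) (s - 1)"
      using m(1,2) P by (simp add: connected_partitions_def)
    then show False using no[of "A \<union> B" ?P] AB by simp
  qed
  show ?thesis
    unfolding beta_eq_sum[OF G(1) assms(8) r_def s_def] beta_eq_sum[OF D assms(9) r' s'] C
  proof (rule sum.cong[OF refl])
    fix P assume P: "P \<in> connected_partitions G r s"
    let ?K = "partition_graph G P" and ?S = "part_of P"
    have part: "partition_on (verts G) P"
      using P by (simp add: connected_partitions_def connected_partition_def)
    have K: "multigraph ?K" by (rule multigraph_partition_graph[OF G(1) part])
    have "q2 \<in> verts G" using assms(9) by (simp add: delete_edge_def)
    then have "?S q1 \<in> verts ?K" "?S q2 \<in> verts ?K"
      using part_of_in[OF part] assms(8) by (simp_all add: partition_graph_def)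
    \<comment> \<open>The sink is moved from the part of \<open>q1\<close> to that of
      \<open>q2\<close> while \<open>e\<close> is still present; deletion then happens with the sink
      fixed.\<close>
    then have 1: "card (unique_sink_orientations ?K (?S q1)) = card (unique_sink_orientations ?K (?S q2))"
      by (rule card_unique_sink_orientations_eq[OF K])
    have "e \<in> edges ?K" using crossing[of P] no[of _ P] P by blast
    then have "card (unique_sink_orientations (delete_edge ?K e) (?S q2)) =
        card (unique_sink_orientations ?K (?S q2))"
      using parallel[OF P] card_unique_sink_orientations_delete_parallel[OF K] by blast
    then show "card (unique_sink_orientations ?K (?S q1)) =
        card (unique_sink_orientations (partition_graph ?D P) (?S q2))"
      using 1 by (simp add: partition_graph_delete_edge)
  qed
qed

end
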